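(* Let $X$ be a finite set and let $f:2^X\to\mathbb{R}$ be a non-decreasing function such that $f(\emptyset)=0$. Then $f$ is XOS if and only if there is $k\ge1$, a map $\phi:X\to\mathbb{R}^k$ and a compact convex set $K\subseteq\mathbb{R}^k$ with nonempty interior such that, for all $A\subseteq X$, $$f(A)=R(\phi(A)\cup\{0\},K)=\inf\{\lambda\ge0:\phi(A)\cup\{0\}\subseteq\lambda K+z\text{ for some }z\in\mathbb{R}^k\}.$$
   Context: A function $f:2^X\to\mathbb{R}$ is non-decreasing if $A\subseteq B$ implies $f(A)\le f(B)$. A function $f:2^X\to\mathbb{R}$ is additive if there are non-negative weights $\{w_x\}_{x\in X}$ such that $f(\emptyset)=0$ and $f(A)=\sum_{a\in A}w_a$ for all nonempty $A\subseteq X$. A function $f:2^X\to\mathbb{R}$ is XOS if there are finitely many (at least one) additive functions $f_1,\ldots,f_m$ on $2^X$ such that $f(A)=\max\{f_i(A):i=1,\ldots,m\}$ for all $A\subseteq X$. For a compact convex set $K\subseteq\mathbb{R}^k$ with nonempty interior and a bounded set $S\subseteq\mathbb{R}^k$, the generalized circumradius is $R(S,K)=\inf\{\lambda\ge0:S\subseteq\lambda K+z\text{ for some }z\in\mathbb{R}^k\}$. $\phi(A)=\{\phi(a):a\in A\}$, and $\phi$ need not be injective. *)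

theory Defs
  imports "HOL-Analysis.Analysis"
begin

definition additive_on :: "'a set \<Rightarrow> ('a set \<Rightarrow> real) \<Rightarrow> bool" where
  "additive_on X f \<longleftrightarrow>
     (\<exists>w :: 'a \<Rightarrow> real. (\<forall>x\<in>X. 0 \<le> w x) \<and> f {} = 0 \<and>
        (\<forall>A. A \<subseteq> X \<and> A \<noteq> {} \<longrightarrow> f A = (\<Sum>a\<in>A. w a)))"

definition xos_on :: "'a set \<Rightarrow> ('a set \<Rightarrow> real) \<Rightarrow> bool" where
  "xos_on X f \<longleftrightarrow>
     (\<exists>m::nat. 1 \<le> m \<and>
        (\<exists>g :: nat \<Rightarrow> 'a set \<Rightarrow> real.
           (\<forall>i\<in>{1..m}. additive_on X (g i)) \<and>
           (\<forall>A. A \<subseteq> X \<longrightarrow> f A = Max ((\<lambda>i. g i A) ` {1..m}))))"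

text \<open>
  The dimension \<open>k\<close> has to be quantified inside formulas, so it cannot be a type. The space
  of dimension \<open>k\<close> is the library's \<^const>\<open>Euclidean_space\<close> \<open>k\<close>: its points are the functions of
  type \<^typ>\<open>nat \<Rightarrow> real\<close> that vanish at all indices \<open>i \<ge> k\<close>. This function type is not an
  instance of \<^class>\<open>real_vector\<close>, so the library's \<^const>\<open>convex\<close> does not apply; the
  following is its definition with the vector operations written out coordinatewise.
\<close>

definition convex_fun :: "(nat \<Rightarrow> real) set \<Rightarrow> bool" where
  "convex_fun K \<longleftrightarrow>
     (\<forall>x\<in>K. \<forall>y\<in>K. \<forall>u\<ge>0. \<forall>v\<ge>0. u + v = 1 \<longrightarrow> (\<lambda>i. u * x i + v * y i) \<in> K)"

definition convex_body :: "nat \<Rightarrow> (nat \<Rightarrow> real) set \<Rightarrow> bool" where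
  "convex_body k K \<longleftrightarrow>
     compactin (Euclidean_space k) K \<and> convex_fun K \<and> Euclidean_space k interior_of K \<noteq> {}"

definition scaled_translate :: "real \<Rightarrow> (nat \<Rightarrow> real) set \<Rightarrow> (nat \<Rightarrow> real) \<Rightarrow> (nat \<Rightarrow> real) set" where
  "scaled_translate r K z = (\<lambda>y i. r * y i + z i) ` K"

text \<open>
  Where it is used, the set under the infimum is nonempty (\<open>S\<close> is bounded and \<open>K\<close> has nonempty
  interior) and bounded below by 0, so \<^const>\<open>Inf\<close> on the reals is the genuine infimum.
\<close>

definition circumradius :: "nat \<Rightarrow> (nat \<Rightarrow> real) set \<Rightarrow> (nat \<Rightarrow> real) set \<Rightarrow> real" where
  "circumradius k S K =
     Inf {r. 0 \<le> r \<and> (\<exists>z \<in> topspace (Euclidean_space k). S \<subseteq> scaled_translate r K z)}"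

end

theory Submission
  imports Defs
begin

text \<open>
  \<^emph>\<open>From circumradii to XOS.\<close> Given \<open>\<phi>\<close> and \<open>K\<close>, send \<open>x \<in> \<real>\<^sup>X\<close> to the circumradius \<open>p x\<close> of
  the points \<open>x\<^sub>a\<^sup>+ \<phi>(a)\<close> together with the origin. If \<open>S \<subseteq> rK + z\<close> and \<open>T \<subseteq> sK + z'\<close> then
  \<open>S + T \<subseteq> (r + s)K + (z + z')\<close>, and a set \<open>rK + z\<close> that contains the origin contains with every
  point the segment from the origin to it; hence \<open>p\<close> is sublinear
  (\<open>sublinear_weighted_radius\<close>). Moreover \<open>p\<close> extends \<open>f\<close> from indicator functions, and
  \<open>p (-e\<^sub>a) \<le> 0\<close> for each unit vector \<open>e\<^sub>a\<close>. By the Hahn-Banach theorem each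
  \<open>A \<subseteq> X\<close> has a linear functional below \<open>p\<close> that agrees with \<open>p\<close> at the indicator of \<open>A\<close>
  (\<open>supporting_weights\<close>). Its coefficients are non-negative because \<open>p (-e\<^sub>a) \<le> 0\<close>, so it is an
  additive function below \<open>f\<close> that touches \<open>f\<close> at \<open>A\<close>. The maximum of these functions is \<open>f\<close>
  (\<open>xos_onI\<close>).

  \<^emph>\<open>From XOS to circumradii.\<close> Let \<open>f A\<close> be the maximum of the weights \<open>w\<^sub>j(A)\<close>.
  As a first attempt, let \<open>\<phi>(a)\<close> be the unit vector \<open>e\<^sub>a\<close> and let \<open>K\<close> consist of the \<open>y \<le> 0\<close> with
  \<open>\<Sum>\<^sub>a w\<^sub>j(a) y\<^sub>a \<ge> -1\<close> for all \<open>j\<close>. As \<open>K\<close> lies in the negative orthant, \<open>rK + z\<close> contains \<open>e\<^sub>a\<close>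
  only if \<open>z\<^sub>a \<ge> 1\<close>, and it contains the origin only if \<open>z \<ge> 0\<close> and \<open>\<Sum>\<^sub>a w\<^sub>j(a) z\<^sub>a \<le> r\<close>.
  So the best centre for \<open>\<phi>(A) \<union> {0}\<close> is the indicator of \<open>A\<close>, and the smallest radius is
  \<open>max\<^sub>j w\<^sub>j(A) = f A\<close>. This \<open>K\<close> is unbounded when every \<open>w\<^sub>j\<close> vanishes at the same
  element. To repair this, rescale the coordinate of \<open>a\<close> by \<open>c a = f {a}\<close> and add the constraints
  \<open>y \<ge> -1\<close>; because \<open>c a \<le> f A\<close> for \<open>a \<in> A\<close>, they do not change the smallest radius
  (\<open>circumradius_xos_body\<close>).
\<close>

section \<open>Hahn-Banach for finitely many directions\<close>

definition sublinear :: "(('a \<Rightarrow> real) \<Rightarrow> real) \<Rightarrow> bool" where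
  "sublinear p \<longleftrightarrow>
     (\<forall>x y. p (\<lambda>a. x a + y a) \<le> p x + p y) \<and> (\<forall>c\<ge>0. \<forall>x. p (\<lambda>a. c * x a) \<le> c * p x)"

lemma sublinear_add: "sublinear p \<Longrightarrow> p (\<lambda>a. x a + y a) \<le> p x + p y"
  by (simp add: sublinear_def)

lemma sublinear_scale: "sublinear p \<Longrightarrow> 0 \<le> c \<Longrightarrow> p (\<lambda>a. c * x a) \<le> c * p x"
  by (simp add: sublinear_def)

lemma sublinear_zero:
  assumes "sublinear p"
  shows "p (\<lambda>a. 0) = 0"
  using sublinear_add[OF assms, of "\<lambda>a. 0" "\<lambda>a. 0"] sublinear_scale[OF assms, of 0 "\<lambda>a. 0"]
  by simp

lemma sublinear_scale_eq:
  assumes "sublinear p" "0 \<le> c"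
  shows "p (\<lambda>a. c * x a) = c * p x"
proof (cases "c = 0")
  case True
  then show ?thesis using sublinear_zero[OF assms(1)] by simp
next
  case False
  with assms have "p x \<le> (1 / c) * p (\<lambda>a. c * x a)"
    using sublinear_scale[OF assms(1), of "1 / c" "\<lambda>a. c * x a"] by simp
  with False assms(2) have "c * p x \<le> p (\<lambda>a. c * x a)" by (simp add: field_simps)
  with sublinear_scale[OF assms, of x] show ?thesis by simp
qed

lemma sublinear_minus:
  assumes "sublinear p"
  shows "- p (\<lambda>a. - x a) \<le> p x"
  using sublinear_add[OF assms, of x "\<lambda>a. - x a"] sublinear_zero[OF assms] by simp

lemma sublinear_sum:
  assumes "sublinear p" "finite F"
  shows "p (\<lambda>a. \<Sum>b\<in>F. g b a) \<le> (\<Sum>b\<in>F. p (g b))"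
  using assms(2)
proof induction
  case empty
  then show ?case using sublinear_zero[OF assms(1)] by simp
next
  case (insert b F)
  then show ?case
    using sublinear_add[OF assms(1), of "g b" "\<lambda>a. \<Sum>b\<in>F. g b a"] by simp
qed

text \<open>
  Replacing \<open>p x\<close> by the infimum of \<open>p (x + t v) - t p v\<close> over \<open>t \<ge> 0\<close> keeps sublinearity and
  brings the value at \<open>-v\<close> down to at most \<open>- p v\<close> (take \<open>t = 1\<close>), the least value sublinearity
  permits below \<open>p\<close>. This makes the functional linear along \<open>v\<close>.
\<close>
lemma sublinear_linearize_direction:
  fixes v :: "'a \<Rightarrow> real"
  assumes p: "sublinear p"
  obtains q where "sublinear q" "\<And>x. q x \<le> p x" "q v = p v" "q (\<lambda>a. - v a) = - p v"
proof -
  define h where "h x t = p (\<lambda>a. x a + t * v a) - t * p v" for x t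
  define q where "q x = (INF t\<in>{0..}. h x t)" for x
  have "- p (\<lambda>a. - x a) \<le> h x t" if "0 \<le> t" for x t
    using sublinear_add[OF p, of "\<lambda>a. x a + t * v a" "\<lambda>a. - x a"]
      sublinear_scale_eq[OF p that, of v] by (simp add: h_def)
  then have "bdd_below (h x ` {0..})" for x
    by (intro bdd_belowI2) auto
  then have q_le: "q x \<le> h x t" if "0 \<le> t" for x t
    unfolding q_def using that by (intro cINF_lower) auto
  have q_ge: "u \<le> q x" if "\<And>t. 0 \<le> t \<Longrightarrow> u \<le> h x t" for u x
    unfolding q_def using that by (intro cINF_greatest) auto
  have add: "q (\<lambda>a. x a + y a) \<le> q x + q y" for x y
  proof -
    have "q (\<lambda>a. x a + y a) \<le> h x s + h y t" if st: "0 \<le> s" "0 \<le> t" for s t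
    proof -
      have "q (\<lambda>a. x a + y a) \<le> h (\<lambda>a. x a + y a) (s + t)"
        using st by (intro q_le) simp
      also have "\<dots> \<le> h x s + h y t"
        using sublinear_add[OF p, of "\<lambda>a. x a + s * v a" "\<lambda>a. y a + t * v a"]
        by (simp add: h_def algebra_simps)
      finally show ?thesis .
    qed
    then have "q (\<lambda>a. x a + y a) - h x s \<le> q y" if "0 \<le> s" for s
      using that by (intro q_ge) (simp add: algebra_simps)
    then have "q (\<lambda>a. x a + y a) - q y \<le> q x"
      by (intro q_ge) (simp add: algebra_simps)
    then show ?thesis by simp
  qed
  have q_p: "q x \<le> p x" for x
    using q_le[of 0 x] by (simp add: h_def)
  have scale: "q (\<lambda>a. c * x a) \<le> c * q x" if "0 \<le> c" for c x
  proof (cases "c = 0")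
    case True
    then show ?thesis using q_p[of "\<lambda>a. 0"] sublinear_zero[OF p] by simp
  next
    case False
    with that have c: "0 < c" by simp
    have "q (\<lambda>a. c * x a) \<le> c * h x t" if "0 \<le> t" for t
    proof -
      have "q (\<lambda>a. c * x a) \<le> h (\<lambda>a. c * x a) (c * t)"
        using c that by (intro q_le) simp
      also have "\<dots> \<le> c * h x t"
        using sublinear_scale[OF p, of c "\<lambda>a. x a + t * v a"] c
        by (simp add: h_def algebra_simps)
      finally show ?thesis .
    qed
    then have "q (\<lambda>a. c * x a) / c \<le> q x"
      using c by (intro q_ge) (simp add: field_simps)
    then show ?thesis using c by (simp add: field_simps)
  qed
  have q: "sublinear q" using add scale by (simp add: sublinear_def)
  have "q (\<lambda>a. - v a) \<le> - p v"
    using q_le[of 1 "\<lambda>a. - v a"] sublinear_zero[OF p] by (simp add: h_def)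
  with q_p[of v] sublinear_minus[OF q, of v] have "q v = p v" "q (\<lambda>a. - v a) = - p v"
    by linarith+
  with q q_p that show ?thesis by blast
qed

text \<open>
  Linearity along a direction survives every later step, because a sublinear \<open>r \<le> q\<close> satisfies
  \<open>- r (-v) \<le> r v \<le> q v = - q (-v) \<le> - r (-v)\<close>.
\<close>
lemma sublinear_linearize:
  assumes "finite V" "sublinear p"
  shows "\<exists>q. sublinear q \<and> (\<forall>x. q x \<le> p x) \<and> (\<forall>v\<in>V. q (\<lambda>a. - v a) = - q v)"
  using assms(1)
proof induction
  case empty
  then show ?case using assms(2) by auto
next
  case (insert u V)
  then obtain q where q: "sublinear q" "\<And>x. q x \<le> p x" "\<And>v. v \<in> V \<Longrightarrow> q (\<lambda>a. - v a) = - q v"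
    by blast
  obtain r where r: "sublinear r" "\<And>x. r x \<le> q x" "r (\<lambda>a. - u a) = - r u"
    using sublinear_linearize_direction[OF q(1)] by metis
  have "r (\<lambda>a. - v a) = - r v" if "v \<in> V" for v
    using q(3)[OF that] r(2)[of v] r(2)[of "\<lambda>a. - v a"] sublinear_minus[OF r(1), of v] by linarith
  with q r show ?case by (metis insert_iff order_trans)
qed

text \<open>
  Linearizing along the indicator of \<open>A\<close> first lowers the value at its negative to
  \<open>- p (indicator A)\<close>, which forces every smaller sublinear functional to agree with \<open>p\<close> at
  \<open>indicator A\<close>. Linearizing then along the unit vectors yields the coefficients \<open>w\<close>; they are
  non-negative since \<open>- w a\<close> is a value at a negative unit vector.
\<close>
lemma supporting_weights:
  fixes X :: "'a set"
  assumes X: "finite X" and A: "A \<subseteq> X" and p: "sublinear p"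
    and neg: "\<And>a. a \<in> X \<Longrightarrow> p (\<lambda>b. - indicator {a} b) \<le> 0"
  obtains w where "\<forall>a\<in>X. 0 \<le> w a" "\<And>B. B \<subseteq> X \<Longrightarrow> sum w B \<le> p (indicator B)"
    "sum w A = p (indicator A)"
proof -
  obtain q where q: "sublinear q" "\<And>x. q x \<le> p x"
      "q (\<lambda>b. - indicator A b) = - p (indicator A)"
    using sublinear_linearize_direction[OF p] by metis
  have "finite ((\<lambda>a. indicator {a}) ` X :: ('a \<Rightarrow> real) set)" using X by simp
  from sublinear_linearize[OF this q(1)] obtain r where r: "sublinear r" "\<And>x. r x \<le> q x"
      "\<And>a. a \<in> X \<Longrightarrow> r (\<lambda>b. - indicator {a} b) = - r (indicator {a})"
    by auto
  define w where "w a = r (indicator {a})" for a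
  have ind: "(indicator B :: 'a \<Rightarrow> real) = (\<lambda>b. \<Sum>a\<in>B. indicator {a} b)" if "B \<subseteq> X" for B
  proof -
    have "finite B" using that X by (rule finite_subset)
    then show ?thesis by (auto simp: fun_eq_iff indicator_def sum.delta')
  qed
  have sum_eq: "r (indicator B) = sum w B" if B: "B \<subseteq> X" for B
  proof (rule antisym)
    have fin: "finite B" using B X by (rule finite_subset)
    show "r (indicator B) \<le> sum w B"
      using sublinear_sum[OF r(1) fin, of "\<lambda>a. indicator {a}"] by (simp add: ind[OF B] w_def)
    have "r (\<lambda>b. - indicator B b) \<le> (\<Sum>a\<in>B. r (\<lambda>b. - indicator {a} b))"
      using sublinear_sum[OF r(1) fin, of "\<lambda>a b. - indicator {a} b"]
      by (simp add: ind[OF B] sum_negf)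
    also have "\<dots> = - sum w B"
      using B r(3) by (simp add: w_def subset_iff sum_negf)
    finally show "sum w B \<le> r (indicator B)"
      using sublinear_minus[OF r(1), of "indicator B"] by linarith
  qed
  show ?thesis
  proof
    show "\<forall>a\<in>X. 0 \<le> w a"
    proof
      fix a assume "a \<in> X"
      then have "- w a \<le> p (\<lambda>b. - indicator {a} b)"
        using r(3) by (metis r(2) q(2) order_trans w_def)
      with neg[OF \<open>a \<in> X\<close>] show "0 \<le> w a" by linarith
    qed
    show "sum w B \<le> p (indicator B)" if "B \<subseteq> X" for B
      unfolding sum_eq[OF that, symmetric] using r(2) q(2) by (rule order_trans)
    show "sum w A = p (indicator A)"
      using sublinear_minus[OF r(1), of "indicator A"] r(2)[of "\<lambda>b. - indicator A b"] q(3)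
        r(2)[of "indicator A"] q(2)[of "indicator A"] sum_eq[OF A] by linarith
  qed
qed

section \<open>Additive functions and XOS functions\<close>

lemma additive_on_iff_weights:
  "additive_on X f \<longleftrightarrow> (\<exists>w. (\<forall>x\<in>X. 0 \<le> w x) \<and> (\<forall>A\<subseteq>X. f A = sum w A))"
  unfolding additive_on_def by (intro ex_cong1) (metis empty_subsetI sum.empty)

lemma xos_on_iff_weights:
  "xos_on X f \<longleftrightarrow>
     (\<exists>(m::nat) w. 1 \<le> m \<and> (\<forall>j\<in>{1..m}. \<forall>x\<in>X. 0 \<le> w j x) \<and>
        (\<forall>A\<subseteq>X. f A = (MAX j\<in>{1..m}. sum (w j) A)))"
  (is "?xos \<longleftrightarrow> ?weights")
proof
  assume ?xos
  then obtain m g where m: "1 \<le> (m::nat)" and g: "\<forall>j\<in>{1..m}. additive_on X (g j)"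
    and f: "\<forall>A. A \<subseteq> X \<longrightarrow> f A = Max ((\<lambda>j. g j A) ` {1..m})"
    unfolding xos_on_def by blast
  from g obtain w where w: "\<forall>j\<in>{1..m}. (\<forall>x\<in>X. 0 \<le> w j x) \<and> (\<forall>A\<subseteq>X. g j A = sum (w j) A)"
    unfolding additive_on_iff_weights by metis
  have "f A = (MAX j\<in>{1..m}. sum (w j) A)" if "A \<subseteq> X" for A
  proof -
    have "(\<lambda>j. g j A) ` {1..m} = (\<lambda>j. sum (w j) A) ` {1..m}"
      using w that by (intro image_cong) auto
    with f that show ?thesis by simp
  qed
  with m w show ?weights by blast
next
  assume ?weights
  then obtain m w where m: "1 \<le> (m::nat)" and "\<forall>j\<in>{1..m}. \<forall>x\<in>X. 0 \<le> w j x"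
    and f: "\<forall>A\<subseteq>X. f A = (MAX j\<in>{1..m}. sum (w j) A)"
    by blast
  then have "\<forall>j\<in>{1..m}. additive_on X (sum (w j))"
    unfolding additive_on_iff_weights by blast
  with m f show ?xos
    unfolding xos_on_def by (intro exI[of _ m] conjI exI[of _ "\<lambda>j. sum (w j)"]) simp_all
qed

lemma xos_onI:
  assumes X: "finite X"
    and touch: "\<And>A. A \<subseteq> X \<Longrightarrow>
      \<exists>w. (\<forall>x\<in>X. 0 \<le> w x) \<and> (\<forall>B\<subseteq>X. sum w B \<le> f B) \<and> sum w A = f A"
  shows "xos_on X f"
proof -
  obtain w where w: "\<And>A. A \<subseteq> X \<Longrightarrow>
      (\<forall>x\<in>X. 0 \<le> w A x) \<and> (\<forall>B\<subseteq>X. sum (w A) B \<le> f B) \<and> sum (w A) A = f A"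
    using touch by metis
  have fin: "finite (Pow X)" using X by simp
  define m where "m = card (Pow X)"
  obtain h where h: "bij_betw h {1..m} (Pow X)"
    using ex_bij_betw_nat_finite_1[OF fin] unfolding m_def by blast
  have "1 \<le> m" unfolding m_def using X by (simp add: card_Pow)
  moreover have hX: "h j \<subseteq> X" if "j \<in> {1..m}" for j
    using h that by (auto simp: bij_betw_def)
  moreover have "f A = (MAX j\<in>{1..m}. sum (w (h j)) A)" if A: "A \<subseteq> X" for A
  proof (rule Max_eqI[symmetric])
    show "y \<le> f A" if "y \<in> (\<lambda>j. sum (w (h j)) A) ` {1..m}" for y
      using that hX w A by blast
    obtain j where "j \<in> {1..m}" "h j = A"
      using h A by (metis PowI bij_betw_def imageE)
    then show "f A \<in> (\<lambda>j. sum (w (h j)) A) ` {1..m}"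
      using w[OF A] by (intro image_eqI[of _ _ j]) simp_all
  qed simp
  ultimately show ?thesis
    unfolding xos_on_iff_weights using w by (intro exI[of _ m] exI[of _ "\<lambda>j. w (h j)"]) blast
qed

section \<open>Radii at which a translate covers a set\<close>

definition covering_radii :: "nat \<Rightarrow> (nat \<Rightarrow> real) set \<Rightarrow> (nat \<Rightarrow> real) set \<Rightarrow> real set" where
  "covering_radii k S K =
     {r. 0 \<le> r \<and> (\<exists>z \<in> topspace (Euclidean_space k). S \<subseteq> scaled_translate r K z)}"

lemma circumradius_le: "r \<in> covering_radii k S K \<Longrightarrow> circumradius k S K \<le> r"
  unfolding circumradius_def covering_radii_def[symmetric]
  by (rule cInf_lower) (auto intro: bdd_belowI[of _ 0] simp: covering_radii_def)

lemma circumradius_ge: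
  assumes "covering_radii k S K \<noteq> {}" "\<And>r. r \<in> covering_radii k S K \<Longrightarrow> u \<le> r"
  shows "u \<le> circumradius k S K"
  unfolding circumradius_def covering_radii_def[symmetric]
  using assms by (rule cInf_greatest)

lemma Euclidean_space_eq_top_of_set:
  "Euclidean_space k = top_of_set {x :: nat \<Rightarrow> real. \<forall>i\<ge>k. x i = 0}"
  by (simp add: Euclidean_space_def euclidean_product_topology)

text \<open>
  From an interior point \<open>c\<close> of \<open>K\<close> one can move a little in each of the finitely many directions
  \<open>s \<in> S\<close> without leaving \<open>K\<close>. If \<open>c + t s \<in> K\<close> for all of them, then \<open>S \<subseteq> (1/t) (K - c)\<close>.
\<close>
lemma covering_radii_nonempty:
  assumes K: "convex_body k K" and S: "finite S" "S \<subseteq> topspace (Euclidean_space k)"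
  shows "covering_radii k S K \<noteq> {}"
proof -
  obtain c where c: "c \<in> Euclidean_space k interior_of K"
    using K by (auto simp: convex_body_def)
  have "openin (Euclidean_space k) (Euclidean_space k interior_of K)" by simp
  then obtain T where T: "open T"
      "Euclidean_space k interior_of K = T \<inter> {x. \<forall>i\<ge>k. x i = 0}"
    unfolding Euclidean_space_eq_top_of_set openin_open by blast
  have cE: "\<forall>i\<ge>k. c i = 0" and cT: "c \<in> T" using c T by auto
  have TK: "x \<in> K" if "x \<in> T" "\<forall>i\<ge>k. x i = 0" for x
    using that T(2) interior_of_subset[of "Euclidean_space k" K] by blast
  have "\<forall>\<^sub>F t in at_right 0. (\<lambda>i. c i + t * s i) \<in> T" for s :: "nat \<Rightarrow> real"
  proof -
    have "continuous_on UNIV (\<lambda>t::real. \<lambda>i. c i + t * s i)"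
      by (intro continuous_intros)
    then have "isCont (\<lambda>t::real. \<lambda>i. c i + t * s i) 0"
      by (simp add: continuous_on_eq_continuous_at)
    then have "((\<lambda>t::real. \<lambda>i. c i + t * s i) \<longlongrightarrow> c) (at 0)"
      by (simp add: isCont_def)
    then have "\<forall>\<^sub>F t in at 0. (\<lambda>i. c i + t * s i) \<in> T"
      using T(1) cT by (rule topological_tendstoD)
    then show ?thesis by (simp add: eventually_at_split)
  qed
  then have "\<forall>\<^sub>F t in at_right 0. \<forall>s\<in>S. (\<lambda>i. c i + t * s i) \<in> T"
    using S(1) by (simp add: eventually_ball_finite)
  then have "\<forall>\<^sub>F t::real in at_right 0. 0 < t \<and> (\<forall>s\<in>S. (\<lambda>i. c i + t * s i) \<in> T)"
    by (intro eventually_conj eventually_at_right_less)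
  then obtain t :: real where t: "0 < t" "\<forall>s\<in>S. (\<lambda>i. c i + t * s i) \<in> T"
    using eventually_happens[of _ "at_right (0::real)"] by auto
  have "1 / t \<in> covering_radii k S K"
    unfolding covering_radii_def
  proof (intro CollectI conjI bexI subsetI)
    show "0 \<le> 1 / t" using t by simp
    show "(\<lambda>i. - c i / t) \<in> topspace (Euclidean_space k)"
      using cE by (simp add: topspace_Euclidean_space)
    fix s assume s: "s \<in> S"
    then have "(\<lambda>i. c i + t * s i) \<in> K"
      using t(2) S(2) cE by (intro TK) (auto simp: topspace_Euclidean_space)
    moreover have "s = (\<lambda>i. 1 / t * (c i + t * s i) + - c i / t)"
      using t(1) by (auto simp: field_simps)
    ultimately show "s \<in> scaled_translate (1 / t) K (\<lambda>i. - c i / t)"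
      unfolding scaled_translate_def by (rule rev_image_eqI[where x = "\<lambda>i. c i + t * s i"])
  qed
  then show ?thesis by blast
qed

lemma covering_radii_scale:
  assumes "r \<in> covering_radii k S K" "0 \<le> c"
  shows "c * r \<in> covering_radii k ((\<lambda>s i. c * s i) ` S) K"
proof -
  obtain z where r: "0 \<le> r" and z: "z \<in> topspace (Euclidean_space k)"
    and S: "S \<subseteq> scaled_translate r K z"
    using assms(1) by (auto simp: covering_radii_def)
  have "(\<lambda>s i. c * s i) ` S \<subseteq> scaled_translate (c * r) K (\<lambda>i. c * z i)"
  proof (rule image_subsetI)
    fix s assume "s \<in> S"
    with S obtain y where "y \<in> K" "s = (\<lambda>i. r * y i + z i)"
      by (auto simp: scaled_translate_def)
    then show "(\<lambda>i. c * s i) \<in> scaled_translate (c * r) K (\<lambda>i. c * z i)"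
      unfolding scaled_translate_def
      by (intro image_eqI[of _ _ y]) (simp_all add: algebra_simps)
  qed
  moreover have "(\<lambda>i. c * z i) \<in> topspace (Euclidean_space k)"
    using z by (simp add: topspace_Euclidean_space)
  ultimately show ?thesis
    using r assms(2) by (auto simp: covering_radii_def)
qed

lemma convex_scaled_translate:
  assumes K: "convex_fun K" and st: "s \<in> scaled_translate r K z" "t \<in> scaled_translate r K z"
    and uv: "0 \<le> u" "0 \<le> v" "u + v = 1"
  shows "(\<lambda>i. u * s i + v * t i) \<in> scaled_translate r K z"
proof -
  obtain x y where xy: "x \<in> K" "y \<in> K" "s = (\<lambda>i. r * x i + z i)" "t = (\<lambda>i. r * y i + z i)"
    using st by (auto simp: scaled_translate_def)
  have "(\<lambda>i. u * x i + v * y i) \<in> K"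
    using K xy uv by (simp add: convex_fun_def)
  moreover have "u * s i + v * t i = r * (u * x i + v * y i) + z i" for i
  proof -
    have "u * s i + v * t i = r * (u * x i + v * y i) + (u + v) * z i"
      by (simp add: xy algebra_simps)
    with uv show ?thesis by simp
  qed
  ultimately show ?thesis
    unfolding scaled_translate_def by (intro image_eqI) auto
qed

lemma scaled_translate_add:
  assumes K: "convex_fun K" and rr: "0 \<le> r" "0 \<le> r'"
    and st: "s \<in> scaled_translate r K z" "t \<in> scaled_translate r' K z'"
  shows "(\<lambda>i. s i + t i) \<in> scaled_translate (r + r') K (\<lambda>i. z i + z' i)"
proof -
  obtain x y where xy: "x \<in> K" "y \<in> K" "s = (\<lambda>i. r * x i + z i)" "t = (\<lambda>i. r' * y i + z' i)"
    using st by (auto simp: scaled_translate_def)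
  show ?thesis
  proof (cases "r + r' = 0")
    case True
    with rr have "r = 0" "r' = 0" by auto
    with xy show ?thesis by (auto simp: scaled_translate_def)
  next
    case False
    define y' where "y' i = r / (r + r') * x i + r' / (r + r') * y i" for i
    have "r / (r + r') + r' / (r + r') = 1"
      using False by (simp add: add_divide_distrib[symmetric])
    then have "y' \<in> K"
      using K[unfolded convex_fun_def, rule_format, OF xy(1,2), of "r / (r + r')" "r' / (r + r')"] rr
      by (simp add: y'_def[abs_def])
    moreover have "(r + r') * y' i = r * x i + r' * y i" for i
      using False by (simp add: y'_def distrib_left)
    then have "s i + t i = (r + r') * y' i + (z i + z' i)" for i
      by (simp add: xy)
    ultimately show ?thesis
      unfolding scaled_translate_def by (intro image_eqI) auto
  qed
qed

text \<open>
  The sum \<open>S + T\<close> of sets that contain the origin contains the origin too, so a convex set that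
  covers \<open>S + T\<close> also covers every shrunk point \<open>\<theta> (s + t)\<close>.
\<close>
lemma covering_radii_add:
  assumes K: "convex_fun K"
    and r: "r \<in> covering_radii k S K" and r': "r' \<in> covering_radii k T K"
    and zero: "(\<lambda>i. 0) \<in> S" "(\<lambda>i. 0) \<in> T"
    and U: "\<And>u. u \<in> U \<Longrightarrow> \<exists>\<theta>\<in>{0..1}. \<exists>s\<in>S. \<exists>t\<in>T. u = (\<lambda>i. \<theta> * (s i + t i))"
  shows "r + r' \<in> covering_radii k U K"
proof -
  obtain z where z: "0 \<le> r" "z \<in> topspace (Euclidean_space k)" "S \<subseteq> scaled_translate r K z"
    using r by (auto simp: covering_radii_def)
  obtain z' where z': "0 \<le> r'" "z' \<in> topspace (Euclidean_space k)" "T \<subseteq> scaled_translate r' K z'"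
    using r' by (auto simp: covering_radii_def)
  let ?C = "scaled_translate (r + r') K (\<lambda>i. z i + z' i)"
  have ST: "(\<lambda>i. s i + t i) \<in> ?C" if "s \<in> S" "t \<in> T" for s t
    using that z z' by (intro scaled_translate_add[OF K]) auto
  have "U \<subseteq> ?C"
  proof
    fix u assume "u \<in> U"
    from U[OF this] obtain \<theta> s t
      where st: "0 \<le> \<theta>" "\<theta> \<le> 1" "s \<in> S" "t \<in> T" "u = (\<lambda>i. \<theta> * (s i + t i))"
      unfolding Bex_def atLeastAtMost_iff by blast
    then show "u \<in> ?C"
      using convex_scaled_translate[OF K ST[OF st(3,4)] ST[OF zero], of \<theta> "1 - \<theta>"] by simp
  qed
  moreover have "(\<lambda>i. z i + z' i) \<in> topspace (Euclidean_space k)"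
    using z z' by (simp add: topspace_Euclidean_space)
  ultimately show ?thesis
    using z z' by (auto simp: covering_radii_def)
qed

section \<open>Circumradii of weighted point sets\<close>

text \<open>
  The positive part gives \<open>-e\<^sub>a\<close> the same points as the zero weight, which is the source of
  non-negative coefficients. Since \<open>(x + y)\<^sup>+ \<le> x\<^sup>+ + y\<^sup>+\<close>, it does not spoil subadditivity.
\<close>
definition weighted_points ::
    "'a set \<Rightarrow> ('a \<Rightarrow> nat \<Rightarrow> real) \<Rightarrow> ('a \<Rightarrow> real) \<Rightarrow> (nat \<Rightarrow> real) set" where
  "weighted_points X \<phi> x = (\<lambda>a i. max 0 (x a) * \<phi> a i) ` X \<union> {\<lambda>i. 0}"

lemma weighted_points_indicator:
  assumes "A \<subseteq> X"
  shows "weighted_points X \<phi> (indicator A) = \<phi> ` A \<union> {\<lambda>i. 0}"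
  using assms unfolding weighted_points_def by (force simp: indicator_def image_iff)

lemma weighted_points_nonpos:
  assumes "\<And>a. x a \<le> 0"
  shows "weighted_points X \<phi> x = {\<lambda>i. 0}"
  using assms unfolding weighted_points_def by (auto simp: max_absorb1)

lemma weighted_points_scale:
  assumes "0 \<le> c"
  shows "weighted_points X \<phi> (\<lambda>a. c * x a) = (\<lambda>s i. c * s i) ` weighted_points X \<phi> x"
proof -
  have "max 0 (c * x a) = c * max 0 (x a)" for a
    using assms max_mult_distrib_left[of c 0 "x a"] by simp
  then show ?thesis
    unfolding weighted_points_def by (simp add: image_Un image_image mult.assoc)
qed

lemma weighted_points_add:
  assumes "u \<in> weighted_points X \<phi> (\<lambda>a. x a + y a)"
  shows "\<exists>\<theta>\<in>{0..1}. \<exists>s\<in>weighted_points X \<phi> x. \<exists>t\<in>weighted_points X \<phi> y.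
    u = (\<lambda>i. \<theta> * (s i + t i))"
proof (cases "u = (\<lambda>i. 0)")
  case True
  then show ?thesis
    by (intro bexI[of _ "0::real"] bexI[of _ "\<lambda>i. 0"]) (auto simp: weighted_points_def)
next
  case False
  with assms obtain a where a: "a \<in> X" "u = (\<lambda>i. max 0 (x a + y a) * \<phi> a i)"
    by (auto simp: weighted_points_def)
  define m where "m = max 0 (x a) + max 0 (y a)"
  \<comment> \<open>If \<open>m = 0\<close> then \<open>\<theta> = 0\<close>, which is right because the weight \<open>max 0 (x a + y a)\<close> is 0 too.\<close>
  define \<theta> where "\<theta> = max 0 (x a + y a) / m"
  have "0 \<le> max 0 (x a + y a)" "max 0 (x a + y a) \<le> m" by (auto simp: m_def)
  then have \<theta>: "\<theta> \<in> {0..1}" "max 0 (x a + y a) = \<theta> * m"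
    by (auto simp: \<theta>_def divide_le_eq_1)
  then have "u = (\<lambda>i. \<theta> * (max 0 (x a) * \<phi> a i + max 0 (y a) * \<phi> a i))"
    unfolding a(2) m_def by (simp add: algebra_simps)
  then show ?thesis
    using a(1) \<theta>(1) unfolding weighted_points_def
    by (intro bexI[of _ \<theta>] bexI[of _ "\<lambda>i. max 0 (x a) * \<phi> a i"]
        bexI[of _ "\<lambda>i. max 0 (y a) * \<phi> a i"]) auto
qed

lemma sublinear_weighted_radius:
  assumes X: "finite X" and \<phi>: "\<phi> \<in> X \<rightarrow> topspace (Euclidean_space k)" and K: "convex_body k K"
  shows "sublinear (\<lambda>x. circumradius k (weighted_points X \<phi> x) K)"
proof -
  let ?W = "weighted_points X \<phi>"
  let ?p = "\<lambda>x. circumradius k (?W x) K"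
  have conv: "convex_fun K" using K by (simp add: convex_body_def)
  have ne: "covering_radii k (?W x) K \<noteq> {}" for x
    using X \<phi> by (intro covering_radii_nonempty[OF K])
      (auto simp: weighted_points_def topspace_Euclidean_space Pi_iff)
  have add: "?p (\<lambda>a. x a + y a) \<le> ?p x + ?p y" for x y
  proof -
    have le: "?p (\<lambda>a. x a + y a) \<le> r + s"
      if "r \<in> covering_radii k (?W x) K" "s \<in> covering_radii k (?W y) K" for r s
      using that by (intro circumradius_le covering_radii_add[OF conv, where S = "?W x" and T = "?W y"]
          weighted_points_add) (auto simp: weighted_points_def)
    have "?p (\<lambda>a. x a + y a) - r \<le> ?p y" if "r \<in> covering_radii k (?W x) K" for r
    proof (rule circumradius_ge[OF ne])
      fix s assume "s \<in> covering_radii k (?W y) K"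
      from le[OF that this] show "?p (\<lambda>a. x a + y a) - r \<le> s" by linarith
    qed
    then have "?p (\<lambda>a. x a + y a) - ?p y \<le> ?p x"
      by (intro circumradius_ge[OF ne]) (simp add: algebra_simps)
    then show ?thesis by simp
  qed
  have scale: "?p (\<lambda>a. c * x a) \<le> c * ?p x" if c: "0 \<le> c" for c x
  proof -
    have le: "?p (\<lambda>a. c * x a) \<le> c * r" if "r \<in> covering_radii k (?W x) K" for r
      unfolding weighted_points_scale[OF c]
      using that c by (intro circumradius_le covering_radii_scale)
    show ?thesis
    proof (cases "c = 0")
      case True
      then show ?thesis using le ne[of x] by fastforce
    next
      case False
      with le c have "?p (\<lambda>a. c * x a) / c \<le> ?p x"
        by (intro circumradius_ge[OF ne]) (simp add: field_simps)
      with False c show ?thesis by (simp add: field_simps)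
    qed
  qed
  show ?thesis using add scale by (simp add: sublinear_def)
qed

lemma xos_on_circumradius:
  assumes X: "finite X" and \<phi>: "\<phi> \<in> X \<rightarrow> topspace (Euclidean_space k)" and K: "convex_body k K"
    and f: "\<And>A. A \<subseteq> X \<Longrightarrow> f A = circumradius k (\<phi> ` A \<union> {\<lambda>i. 0}) K"
  shows "xos_on X f"
proof (rule xos_onI[OF X])
  fix A assume A: "A \<subseteq> X"
  define p where "p x = circumradius k (weighted_points X \<phi> x) K" for x
  have p: "sublinear p"
    using sublinear_weighted_radius[OF X \<phi> K] by (simp add: p_def[abs_def])
  have f_p: "f B = p (indicator B)" if "B \<subseteq> X" for B
    using f[OF that] by (simp add: p_def weighted_points_indicator[OF that])
  have "p (\<lambda>b. - indicator {a} b) = p (\<lambda>b. 0)" for a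
    by (simp add: p_def weighted_points_nonpos)
  then have "p (\<lambda>b. - indicator {a} b) \<le> 0" for a
    using sublinear_zero[OF p] by simp
  from supporting_weights[OF X A p this] show
    "\<exists>w. (\<forall>x\<in>X. 0 \<le> w x) \<and> (\<forall>B\<subseteq>X. sum w B \<le> f B) \<and> sum w A = f A"
    using f_p A by metis
qed

section \<open>A convex body for an XOS function\<close>

text \<open>
  The coordinate of \<open>a \<in> X\<close> is \<open>g a\<close>. The lower bound \<open>-1\<close> makes the set bounded even along
  coordinates to which every \<open>v j\<close> gives weight 0.
\<close>
definition xos_body ::
    "nat \<Rightarrow> 'a set \<Rightarrow> ('a \<Rightarrow> nat) \<Rightarrow> 'j set \<Rightarrow> ('j \<Rightarrow> 'a \<Rightarrow> real) \<Rightarrow> (nat \<Rightarrow> real) set" where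
  "xos_body k X g J v =
     {y. (\<forall>i. (if i < k then -1 else 0) \<le> y i \<and> y i \<le> 0) \<and>
         (\<forall>j\<in>J. -1 \<le> (\<Sum>a\<in>X. v j a * y (g a)))}"

lemma compact_xos_body: "compact (xos_body k X g J v)"
proof -
  define B where "B i = {if i < k then -1 else 0..0::real}" for i :: nat
  have "compactin (powertop_real UNIV) (Pi\<^sub>E UNIV B)"
    by (simp add: compactin_PiE B_def)
  then have "compact (Pi\<^sub>E UNIV B)"
    by (simp add: euclidean_product_topology)
  moreover have "closed {y :: nat \<Rightarrow> real. \<forall>j\<in>J. -1 \<le> (\<Sum>a\<in>X. v j a * y (g a))}"
    unfolding Collect_ball_eq by (intro closed_INT ballI closed_Collect_le continuous_intros) auto
  ultimately have "compact (Pi\<^sub>E UNIV B \<inter> {y. \<forall>j\<in>J. -1 \<le> (\<Sum>a\<in>X. v j a * y (g a))})"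
    by (rule compact_Int_closed)
  also have "\<dots> = xos_body k X g J v"
    by (simp add: xos_body_def B_def PiE_UNIV_domain Pi_iff Int_def del: if_split_asm)
  finally show ?thesis .
qed

lemma convex_xos_body: "convex_fun (xos_body k X g J v)"
  unfolding convex_fun_def
proof (intro ballI allI impI)
  fix x y u t
  assume x: "x \<in> xos_body k X g J v" and y: "y \<in> xos_body k X g J v"
    and ut: "0 \<le> u" "0 \<le> t" "u + t = (1::real)"
  have ge: "l \<le> u * p + t * q" if "l \<le> p" "l \<le> q" for l p q :: real
    using convex_bound_le[of "- p" "- l" "- q" u t] that ut by simp
  have le: "u * p + t * q \<le> 0" if "p \<le> 0" "q \<le> 0" for p q :: real
    using convex_bound_le[of p 0 q u t] that ut by simp
  have "(\<Sum>a\<in>X. v j a * (u * x (g a) + t * y (g a)))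
      = u * (\<Sum>a\<in>X. v j a * x (g a)) + t * (\<Sum>a\<in>X. v j a * y (g a))" for j
    by (simp add: sum_distrib_left sum.distrib[symmetric] algebra_simps)
  with x y show "(\<lambda>i. u * x i + t * y i) \<in> xos_body k X g J v"
    unfolding xos_body_def mem_Collect_eq using ge le by simp
qed

lemma convex_body_xos_body:
  assumes v: "\<And>j a. j \<in> J \<Longrightarrow> a \<in> X \<Longrightarrow> 0 \<le> v j a \<and> v j a \<le> 1"
    and g: "g ` X \<subseteq> {..<k}" and card: "card X \<le> k" and k: "1 \<le> k"
  shows "convex_body k (xos_body k X g J v)"
  unfolding convex_body_def
proof (intro conjI convex_xos_body)
  let ?K = "xos_body k X g J v"
  have K_sub: "?K \<subseteq> {x. \<forall>i\<ge>k. x i = 0}"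
    by (auto simp: xos_body_def intro: antisym dest: spec leD)
  then show "compactin (Euclidean_space k) ?K"
    by (simp add: Euclidean_space_eq_top_of_set compactin_subtopology compact_xos_body)
  \<comment> \<open>Each of the sums has at most \<open>k\<close> terms, so coordinates between \<open>-1 / k\<close> and 0 suffice.\<close>
  define \<delta> where "\<delta> = 1 / real k"
  have \<delta>: "0 < \<delta>" "\<delta> \<le> 1" using k by (auto simp: \<delta>_def)
  define T where "T = {y :: nat \<Rightarrow> real. \<forall>i\<in>{..<k}. - \<delta> < y i \<and> y i < 0}"
  have "T = (\<Inter>i\<in>{..<k}. {y. - \<delta> < y i} \<inter> {y. y i < 0})"
    by (auto simp: T_def)
  also have "open \<dots>"
    by (intro open_INT open_Int open_Collect_less ballI continuous_intros) auto
  finally have "open T" .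
  then have "openin (Euclidean_space k) (T \<inter> {x. \<forall>i\<ge>k. x i = 0})"
    unfolding Euclidean_space_eq_top_of_set openin_open by blast
  moreover have "T \<inter> {x. \<forall>i\<ge>k. x i = 0} \<subseteq> ?K"
  proof
    fix y assume "y \<in> T \<inter> {x. \<forall>i\<ge>k. x i = 0}"
    then have y: "- \<delta> < y i" "y i < 0" if "i < k" for i
      using that by (auto simp: T_def)
    from \<open>y \<in> _\<close> have y0: "y i = 0" if "i \<ge> k" for i
      using that by auto
    have "-1 \<le> (\<Sum>a\<in>X. v j a * y (g a))" if j: "j \<in> J" for j
    proof -
      have "- \<delta> \<le> v j a * y (g a)" if a: "a \<in> X" for a
      proof -
        have "g a < k" using g a by auto
        then have "v j a * - y (g a) \<le> 1 * \<delta>"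
          using v[OF j a] y[of "g a"] \<delta> by (intro mult_mono) auto
        then show ?thesis by simp
      qed
      then have "real (card X) * - \<delta> \<le> (\<Sum>a\<in>X. v j a * y (g a))"
        by (intro sum_bounded_below)
      moreover have "real (card X) * \<delta> \<le> 1"
        using card k by (simp add: \<delta>_def)
      ultimately show ?thesis by simp
    qed
    moreover have "(if i < k then -1 else 0) \<le> y i \<and> y i \<le> 0" for i
      using y[of i] y0[of i] \<delta> by (cases "i < k") auto
    ultimately show "y \<in> ?K" by (simp add: xos_body_def)
  qed
  ultimately have "T \<inter> {x. \<forall>i\<ge>k. x i = 0} \<subseteq> Euclidean_space k interior_of ?K"
    by (intro interior_of_maximal)
  moreover have "(\<lambda>i. if i < k then - \<delta> / 2 else 0) \<in> T \<inter> {x. \<forall>i\<ge>k. x i = 0}"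
    using \<delta> by (auto simp: T_def)
  ultimately show "Euclidean_space k interior_of ?K \<noteq> {}" by blast
qed

text \<open>
  A translate \<open>r K + z\<close> covering the points must have \<open>z (g a) \<ge> c a\<close> for \<open>a \<in> A\<close>, and covering
  the origin it must have \<open>z \<ge> 0\<close> and \<open>\<Sum>\<^sub>a v\<^sub>j(a) z (g a) \<le> r\<close>. The centre \<open>\<Sum>\<^sub>a\<^sub>\<in>\<^sub>A \<phi>(a)\<close>
  meets the first demands with equality and minimizes the sums.
\<close>
lemma circumradius_xos_body:
  fixes c :: "'a \<Rightarrow> real"
  assumes X: "finite X" and g: "inj_on g X" "g ` X \<subseteq> {..<k}"
    and J: "finite J" "J \<noteq> {}"
    and v: "\<And>j a. j \<in> J \<Longrightarrow> a \<in> X \<Longrightarrow> 0 \<le> v j a"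
    and c: "\<And>a. a \<in> X \<Longrightarrow> 0 \<le> c a"
    and \<phi>: "\<And>a. a \<in> X \<Longrightarrow> \<phi> a = (\<lambda>i. if i = g a then c a else 0)"
    and A: "A \<subseteq> X"
    and M: "M = (MAX j\<in>J. \<Sum>a\<in>A. v j a * c a)"
    and c_le: "\<And>a. a \<in> A \<Longrightarrow> c a \<le> M"
  shows "circumradius k (\<phi> ` A \<union> {\<lambda>i. 0}) (xos_body k X g J v) = M"
proof -
  let ?K = "xos_body k X g J v"
  let ?S = "\<phi> ` A \<union> {\<lambda>i. 0}"
  have fin: "finite A" using A X by (rule finite_subset)
  have M_ge: "(\<Sum>a\<in>A. v j a * c a) \<le> M" if "j \<in> J" for j
    unfolding M using J that by (intro Max_ge) auto
  have M0: "0 \<le> M"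
  proof -
    obtain j where j: "j \<in> J" using J by blast
    have "0 \<le> (\<Sum>a\<in>A. v j a * c a)" using A v[OF j] c by (intro sum_nonneg) auto
    with M_ge[OF j] show ?thesis by simp
  qed
  define z where "z i = (\<Sum>a\<in>A. if i = g a then c a else 0)" for i
  have z_g: "z (g a) = (if a \<in> A then c a else 0)" if "a \<in> X" for a
  proof -
    have "z (g a) = (\<Sum>b\<in>A. if a = b then c b else 0)"
      unfolding z_def using A g(1) that by (intro sum.cong) (auto simp: inj_on_eq_iff subset_iff)
    then show ?thesis using fin by simp
  qed
  have z_out: "z i = 0" if "i \<notin> g ` A" for i
    unfolding z_def using that by (intro sum.neutral) auto
  have z_bound: "0 \<le> z i \<and> z i \<le> M" for i
  proof (cases "i \<in> g ` A")
    case True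
    then obtain a where "a \<in> A" "i = g a" by blast
    with A z_g[of a] c[of a] c_le[of a] show ?thesis by auto
  next
    case False
    with z_out M0 show ?thesis by simp
  qed
  have zE: "z \<in> topspace (Euclidean_space k)"
    using A g(2) by (fastforce simp: topspace_Euclidean_space intro: z_out)
  have "s \<in> scaled_translate M ?K z" if "s \<in> ?S" for s
  proof -
    have s: "0 \<le> s i \<and> s i \<le> z i" for i
    proof (cases "s = (\<lambda>i. 0)")
      case True
      with z_bound show ?thesis by simp
    next
      case False
      with that obtain a where "a \<in> A" "s = \<phi> a" by blast
      with A z_g[of a] c[of a] \<phi>[of a] z_bound[of i] show ?thesis by auto
    qed
    \<comment> \<open>If \<open>M = 0\<close> then \<open>s = z = 0\<close>, and the convention \<open>u / 0 = 0\<close> makes \<open>y\<close> the origin.\<close>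
    define y where "y i = (s i - z i) / M" for i
    have "y \<in> ?K"
      unfolding xos_body_def
    proof (intro CollectI conjI allI ballI)
      fix i
      show "y i \<le> 0" using s[of i] M0 by (simp add: y_def divide_nonpos_nonneg)
      have "i \<notin> g ` A" if "\<not> i < k" using that A g(2) by auto
      then show "(if i < k then -1 else 0) \<le> y i"
        using s[of i] z_bound[of i] M0 z_out[of i]
        by (cases "M = 0") (auto simp: y_def field_simps)
    next
      fix j assume j: "j \<in> J"
      have "(\<Sum>a\<in>X. v j a * z (g a)) = (\<Sum>a\<in>X. if a \<in> A then v j a * c a else 0)"
        using z_g by (intro sum.cong) auto
      also have "\<dots> = (\<Sum>a\<in>A. v j a * c a)"
        using A X by (simp add: sum.inter_restrict[symmetric] Int_absorb1)
      finally have "(\<Sum>a\<in>X. v j a * z (g a)) \<le> M"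
        using M_ge[OF j] by simp
      then have "- 1 \<le> (\<Sum>a\<in>X. v j a * z (g a)) * (- 1 / M)"
        using M0 by (cases "M = 0") (auto simp: field_simps)
      also have "\<dots> = (\<Sum>a\<in>X. v j a * (- z (g a) / M))"
        by (simp add: sum_divide_distrib sum_negf)
      also have "\<dots> \<le> (\<Sum>a\<in>X. v j a * y (g a))"
        unfolding y_def using s v[OF j] M0
        by (intro sum_mono mult_left_mono divide_right_mono) auto
      finally show "-1 \<le> (\<Sum>a\<in>X. v j a * y (g a))" .
    qed
    moreover have "s i = M * y i + z i" for i
      using s[of i] z_bound[of i] by (cases "M = 0") (auto simp: y_def)
    ultimately show ?thesis
      unfolding scaled_translate_def by (intro image_eqI[of _ _ y]) auto
  qed
  then have M_in: "M \<in> covering_radii k ?S ?K"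
    using M0 zE by (auto simp: covering_radii_def simp del: Un_insert_right)
  have "M \<le> r" if "r \<in> covering_radii k ?S ?K" for r
  proof -
    from that obtain z' where r: "0 \<le> r" and z': "?S \<subseteq> scaled_translate r ?K z'"
      by (auto simp: covering_radii_def simp del: Un_insert_right)
    from z' obtain y where y: "y \<in> ?K" "\<And>i. 0 = r * y i + z' i"
      by (auto simp: scaled_translate_def fun_eq_iff)
    have z_y: "z' i = - r * y i" for i using y(2)[of i] by simp
    have z'0: "0 \<le> z' i" for i
      using y(1) r by (simp add: z_y xos_body_def mult_nonneg_nonpos)
    have z'c: "c a \<le> z' (g a)" if a: "a \<in> A" for a
    proof -
      from z' a obtain y' where y': "y' \<in> ?K" "\<phi> a = (\<lambda>i. r * y' i + z' i)"
        by (auto simp: scaled_translate_def)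
      have "c a = r * y' (g a) + z' (g a)"
        using A a \<phi>[of a] fun_cong[OF y'(2), of "g a"] by auto
      moreover have "r * y' (g a) \<le> 0"
        using y'(1) r by (simp add: xos_body_def mult_nonneg_nonpos)
      ultimately show ?thesis by simp
    qed
    have "(\<Sum>a\<in>A. v j a * c a) \<le> r" if j: "j \<in> J" for j
    proof -
      have "(\<Sum>a\<in>A. v j a * c a) \<le> (\<Sum>a\<in>A. v j a * z' (g a))"
        using A v[OF j] z'c by (intro sum_mono mult_left_mono) auto
      also have "\<dots> \<le> (\<Sum>a\<in>X. v j a * z' (g a))"
        using A X v[OF j] z'0 by (intro sum_mono2) auto
      also have "\<dots> = - r * (\<Sum>a\<in>X. v j a * y (g a))"
        by (simp add: z_y sum_distrib_left algebra_simps)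
      also have "\<dots> \<le> r"
      proof -
        have "-1 \<le> (\<Sum>a\<in>X. v j a * y (g a))" using y(1) j by (simp add: xos_body_def)
        from mult_left_mono[OF this r] show ?thesis by simp
      qed
      finally show ?thesis .
    qed
    then show "M \<le> r" unfolding M using J by simp
  qed
  with M_in show ?thesis
    by (intro antisym circumradius_le circumradius_ge) auto
qed

lemma circumradius_of_xos_on:
  assumes X: "finite X" and mono: "mono_on (Pow X) f" and xos: "xos_on X f"
  obtains k \<phi> K where "1 \<le> k" "\<phi> \<in> X \<rightarrow> topspace (Euclidean_space k)" "convex_body k K"
    "\<And>A. A \<subseteq> X \<Longrightarrow> f A = circumradius k (\<phi> ` A \<union> {\<lambda>i. 0}) K"
proof -
  obtain m w where m: "1 \<le> (m::nat)" and w: "\<forall>j\<in>{1..m}. \<forall>x\<in>X. 0 \<le> w j x"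
    and f: "\<forall>A\<subseteq>X. f A = (MAX j\<in>{1..m}. sum (w j) A)"
    using xos unfolding xos_on_iff_weights by blast
  let ?J = "{1..m}"
  have J: "finite ?J" "?J \<noteq> {}" using m by auto
  define c where "c a = f {a}" for a
  define v where "v j a = w j a / c a" for j a
  have w_c: "0 \<le> w j a \<and> w j a \<le> c a" if "j \<in> ?J" "a \<in> X" for j a
    using f w that by (auto simp: c_def intro!: Max_ge)
  have c0: "0 \<le> c a" if "a \<in> X" for a
    using w_c[of 1 a] m that by auto
  have v01: "0 \<le> v j a \<and> v j a \<le> 1" if "j \<in> ?J" "a \<in> X" for j a
    using w_c[OF that] by (auto simp: v_def divide_le_eq_1)
  have vc: "v j a * c a = w j a" if "j \<in> ?J" "a \<in> X" for j a
    using w_c[OF that] by (auto simp: v_def)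
  obtain g where g: "bij_betw g X {0..<card X}"
    using ex_bij_betw_finite_nat[OF X] by blast
  \<comment> \<open>One coordinate more than needed keeps the dimension positive when \<open>X\<close> is empty.\<close>
  define k where "k = Suc (card X)"
  have gk: "inj_on g X" "g ` X \<subseteq> {..<k}"
    using g by (auto simp: bij_betw_def k_def)
  define \<phi> where "\<phi> a = (\<lambda>i. if i = g a then c a else 0)" for a
  show thesis
  proof
    show "1 \<le> k" by (simp add: k_def)
    show "\<phi> \<in> X \<rightarrow> topspace (Euclidean_space k)"
      using gk(2) by (auto simp: \<phi>_def topspace_Euclidean_space)
    show "convex_body k (xos_body k X g ?J v)"
      using v01 gk(2) by (intro convex_body_xos_body) (auto simp: k_def)
    fix A assume A: "A \<subseteq> X"
    have "(\<lambda>j. \<Sum>a\<in>A. v j a * c a) ` ?J = (\<lambda>j. sum (w j) A) ` ?J"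
      using A vc by (intro image_cong sum.cong) auto
    then have "f A = (MAX j\<in>?J. \<Sum>a\<in>A. v j a * c a)"
      using f A by simp
    moreover have "c a \<le> f A" if "a \<in> A" for a
      unfolding c_def using mono A that by (intro mono_onD[OF mono]) auto
    ultimately show "f A = circumradius k (\<phi> ` A \<union> {\<lambda>i. 0}) (xos_body k X g ?J v)"
      using circumradius_xos_body[OF X gk J, of v c \<phi> A "f A"] v01 c0 A \<phi>_def by simp
  qed
qed

theorem theorem23:
  fixes X :: "'a set" and f :: "'a set \<Rightarrow> real"
  assumes "finite X"
    and "mono_on (Pow X) f"
    and "f {} = 0"
  shows "xos_on X f \<longleftrightarrow>
    (\<exists>(k::nat) (\<phi> :: 'a \<Rightarrow> nat \<Rightarrow> real) (K :: (nat \<Rightarrow> real) set).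
       1 \<le> k \<and> \<phi> \<in> X \<rightarrow> topspace (Euclidean_space k) \<and> convex_body k K \<and>
       (\<forall>A. A \<subseteq> X \<longrightarrow> f A = circumradius k (\<phi> ` A \<union> {\<lambda>i. 0}) K))"
proof
  assume "xos_on X f"
  from circumradius_of_xos_on[OF assms(1,2) this] show
    "\<exists>(k::nat) (\<phi> :: 'a \<Rightarrow> nat \<Rightarrow> real) (K :: (nat \<Rightarrow> real) set).
       1 \<le> k \<and> \<phi> \<in> X \<rightarrow> topspace (Euclidean_space k) \<and> convex_body k K \<and>
       (\<forall>A. A \<subseteq> X \<longrightarrow> f A = circumradius k (\<phi> ` A \<union> {\<lambda>i. 0}) K)"
    by metis
next
  assume "\<exists>(k::nat) (\<phi> :: 'a \<Rightarrow> nat \<Rightarrow> real) (K :: (nat \<Rightarrow> real) set).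
       1 \<le> k \<and> \<phi> \<in> X \<rightarrow> topspace (Euclidean_space k) \<and> convex_body k K \<and>
       (\<forall>A. A \<subseteq> X \<longrightarrow> f A = circumradius k (\<phi> ` A \<union> {\<lambda>i. 0}) K)"
  then show "xos_on X f"
    using xos_on_circumradius[OF assms(1)] by blast
qed

end
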